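(* Let $S\neq\mathbb Z_{\ge 0}$ be a numerical semigroup, let $m\in S$ be nonzero, and let $c_1<\dots<c_n$ be the elements of $\mathbb Z_{\ge 0}\setminus S$. Then for all integers $k\ge 1$ and $1\le p<m$ $$\prod_{i=1}^n\ \prod_{J\subset T_i\setminus\{0\},\ |J|=p-1}\left(1+\frac{\sum_{j=1}^k\binom{k}{j}c_i^{k-j}m^j}{\sum_{a\in J}a^k+c_i^k}\right)=\frac{\prod_{I\subset S^{(m)}\setminus\{0\},\ |I|=p}\ \sum_{a\in I}a^k}{\prod_{I\subset I_m\setminus\{0\},\ |I|=p}\ \sum_{a\in I}a^k}.$$ In particular, for $p=m-1$, $$\prod_{i=1}^n\left(1+\frac{\sum_{j=1}^k\binom{k}{j}c_i^{k-j}m^j}{\sum_{a\in T_i}a^k+c_i^k}\right)=\frac{\sum_{a\in S^{(m)}}a^k}{\sum_{a\in I_m}a^k},$$ and for $p=1$, $$\prod_{i=1}^n\left(1+\frac{m}{c_i}\right)=\frac{\prod_{a\in S^{(m)}\setminus\{0\}}a}{(m-1)!}.$$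
   Context: A numerical semigroup is a set $S\subset\mathbb Z_{\ge 0}$ that contains $0$, is closed under addition and has finite complement in $\mathbb Z_{\ge 0}$. For a numerical semigroup $S$ and a nonzero $m\in S$, the Apéry set is $S^{(m)}:=\{s\in S: s-m\notin S\}$; it has exactly $m$ elements, one in each residue class mod $m$, and contains $0$. Put $I_m:=\{0,1,\dots,m-1\}$. With $\mathbb Z_{\ge 0}\setminus S=\{c_1<\dots<c_n\}$, let $S_0:=\mathbb Z_{\ge 0}$ and $S_i:=\mathbb Z_{\ge 0}\setminus\{c_1,\dots,c_i\}$ for $i=1,\dots,n$ (so $S_n=S$); each $S_i$ is a numerical semigroup containing $m$. For $i=1,\dots,n$ put $T_i:=S_i^{(m)}\setminus\{c_i+m\}=S_{i-1}^{(m)}\setminus\{c_i\}$, a set of $m-1$ elements containing $0$. Empty sums equal $0$. *)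

theory Defs
  imports Complex_Main
begin

definition numerical_semigroup :: "nat set \<Rightarrow> bool" where
  "numerical_semigroup S \<longleftrightarrow> 0 \<in> S \<and> (\<forall>a\<in>S. \<forall>b\<in>S. a + b \<in> S) \<and> finite (UNIV - S)"

(* The difference is taken in the integers: truncated subtraction on nat would wrongly
   drop every element s < m, including 0. *)
definition apery_set :: "nat set \<Rightarrow> nat \<Rightarrow> nat set" where
  "apery_set S m = {s \<in> S. int s - int m \<notin> int ` S}"

(* With c 1 < ... < c n the gaps of S, these are the semigroups S_0 = UNIV, ..., S_n = S. *)
definition gap_semigroup :: "(nat \<Rightarrow> nat) \<Rightarrow> nat \<Rightarrow> nat set" where
  "gap_semigroup c i = UNIV - c ` {1..i}"

definition trimmed_apery :: "(nat \<Rightarrow> nat) \<Rightarrow> nat \<Rightarrow> nat \<Rightarrow> nat set" where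
  "trimmed_apery c m i = apery_set (gap_semigroup c i) m - {c i + m}"

end

theory Submission
  imports Defs
begin

text \<open>Filling the gaps one at a time, in increasing order, changes the Apery set in a single
  element: \<open>g\<close> is replaced by \<open>g + m\<close>. Each of the three products telescopes along the chain
  of semigroups, the factor at a gap being the quotient of the values of one function of the
  Apery set before and after that replacement.\<close>

section \<open>Apery sets and the removal of a single element\<close>

text \<open>Trades the integer difference for one on \<open>nat\<close>. Splitting off
  \<open>s < m\<close> keeps truncation harmless, since there \<open>s - m\<close> would be
  0.\<close>

lemma apery_set_iff: "s \<in> apery_set X m \<longleftrightarrow> s \<in> X \<and> (s < m \<or> s - m \<notin> X)"
proof -
  have "int s - int m \<in> int ` X \<longleftrightarrow> m \<le> s \<and> s - m \<in> X"
  proof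
    assume "int s - int m \<in> int ` X"
    then obtain x where "x \<in> X" "int s - int m = int x" by auto
    then have "s = x + m" by linarith
    with \<open>x \<in> X\<close> show "m \<le> s \<and> s - m \<in> X" by simp
  next
    assume "m \<le> s \<and> s - m \<in> X"
    then show "int s - int m \<in> int ` X"
      by (metis image_eqI of_nat_diff)
  qed
  then show ?thesis
    by (auto simp: apery_set_def)
qed

lemma apery_set_UNIV: "apery_set UNIV m = {..<m}"
  by (auto simp: apery_set_iff)

text \<open>Membership of \<open>s\<close> depends only on whether \<open>s\<close> and
  \<open>s - m\<close> lie in the set, so deleting \<open>g\<close> can matter only for
  \<open>s = g\<close> and \<open>s = g + m\<close>. The first leaves the Apery set; the second
  enters it because its predecessor \<open>g\<close> is gone.\<close>

lemma apery_set_remove: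
  assumes "g \<in> X" "g + m \<in> X" "g < m \<or> g - m \<notin> X" "g \<noteq> 0" "m \<noteq> 0"
  defines "T \<equiv> apery_set (X - {g}) m - {g + m}"
  shows "apery_set X m = insert g T"
    and "apery_set (X - {g}) m = insert (g + m) T"
    and "g \<notin> T" and "g + m \<notin> T"
proof -
  have shift: "s - m = g \<longleftrightarrow> s = g + m" if "\<not> s < m" for s
    using that by auto
  show "apery_set X m = insert g T"
  proof (rule set_eqI)
    fix s
    consider "s = g" | "s = g + m" | "s \<noteq> g" "s \<noteq> g + m" by blast
    then show "s \<in> apery_set X m \<longleftrightarrow> s \<in> insert g T"
    proof cases
      case 3
      then show ?thesis
        using shift[of s] by (auto simp: T_def apery_set_iff)
    qed (use assms in \<open>auto simp: T_def apery_set_iff\<close>)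
  qed
  show "apery_set (X - {g}) m = insert (g + m) T"
  proof -
    have "g + m \<in> apery_set (X - {g}) m"
      using assms(2,5) by (simp add: apery_set_iff)
    then show ?thesis unfolding T_def by blast
  qed
qed (use assms(4,5) in \<open>auto simp: T_def apery_set_iff\<close>)

section \<open>Products over subsets of fixed size, and telescoping\<close>

text \<open>A multiplicative Pascal rule: the subsets are sorted by whether they contain
  \<open>x\<close>, and those that do correspond to \<open>q\<close>-subsets of
  \<open>B\<close>.\<close>

lemma prod_subsets_insert:
  fixes f :: "'a set \<Rightarrow> 'b::comm_monoid_mult"
  assumes "finite B" "x \<notin> B"
  shows "(\<Prod>I\<in>{I. I \<subseteq> insert x B \<and> card I = Suc q}. f I)
    = (\<Prod>I\<in>{I. I \<subseteq> B \<and> card I = Suc q}. f I) * (\<Prod>J\<in>{J. J \<subseteq> B \<and> card J = q}. f (insert x J))"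
proof -
  let ?N = "{I. I \<subseteq> B \<and> card I = Suc q}" and ?J = "{J. J \<subseteq> B \<and> card J = q}"
  have card_insert: "card (insert x J) = Suc (card J)" if "J \<subseteq> B" for J
    using that assms by (metis card_insert_disjoint finite_subset subsetD)
  have split: "{I. I \<subseteq> insert x B \<and> card I = Suc q} = ?N \<union> insert x ` ?J"
  proof (intro set_eqI iffI)
    fix I assume I: "I \<in> {I. I \<subseteq> insert x B \<and> card I = Suc q}"
    show "I \<in> ?N \<union> insert x ` ?J"
    proof (cases "x \<in> I")
      case True
      then have insert: "insert x (I - {x}) = I" and sub: "I - {x} \<subseteq> B"
        using I by auto
      have "card (I - {x}) = q"
        using I card_insert[OF sub] unfolding insert by simp
      with sub have "insert x (I - {x}) \<in> insert x ` ?J"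
        by (intro imageI) simp
      then show ?thesis
        unfolding insert by simp
    qed (use I in auto)
  qed (auto simp: card_insert)
  have fin: "finite ?N" "finite ?J"
    using assms(1) by (auto intro: finite_subset[of _ "Pow B"])
  have "inj_on (insert x) ?J"
    using assms(2) by (intro inj_onI) (metis (mono_tags, lifting) insert_ident mem_Collect_eq subsetD)
  moreover have "?N \<inter> insert x ` ?J = {}"
    using assms(2) by auto
  ultimately show ?thesis
    using fin by (simp add: split prod.union_disjoint prod.reindex)
qed

text \<open>The step is a multiplication rather than a quotient, so only \<open>F 0\<close> has to
  be shown nonzero.\<close>

lemma prod_telescope_ratio:
  fixes F :: "nat \<Rightarrow> 'a::field"
  assumes "F 0 \<noteq> 0" and "\<And>i. i < n \<Longrightarrow> F (Suc i) = F i * r (Suc i)"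
  shows "(\<Prod>i=1..n. r i) = F n / F 0"
proof -
  have "F 0 * (\<Prod>i=1..n. r i) = F n"
    using assms(2) by (induction n) (auto simp: mult.assoc[symmetric])
  then show ?thesis
    using assms(1) by (auto simp: field_simps)
qed

lemma sum_powers_pos:
  assumes "finite J" "x \<in> J" "x \<noteq> 0"
  shows "(\<Sum>a\<in>J. real a ^ k) > 0"
  using assms by (intro sum_pos2[of J x]) auto

text \<open>By the binomial theorem the sum from \<open>j = 1\<close> is
  \<open>(x + y) ^ k - x ^ k\<close>, the term \<open>j = 0\<close> being the missing
  \<open>x ^ k\<close>.\<close>

lemma factor_eq_ratio:
  fixes s x y :: real
  assumes "s + x ^ k \<noteq> 0"
  shows "1 + (\<Sum>j=1..k. real (k choose j) * x ^ (k - j) * y ^ j) / (s + x ^ k)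
    = (s + (x + y) ^ k) / (s + x ^ k)"
proof -
  have "(x + y) ^ k = (\<Sum>j\<le>k. real (k choose j) * y ^ j * x ^ (k - j))"
    by (subst add.commute) (rule binomial_ring)
  also have "{..k} = insert 0 {1..k}" by auto
  finally have "(x + y) ^ k = x ^ k + (\<Sum>j=1..k. real (k choose j) * x ^ (k - j) * y ^ j)"
    by (simp add: mult_ac)
  then show ?thesis
    using assms by (simp add: field_simps)
qed

text \<open>One link of the telescope for general subset size. Subsets of \<open>T - {0}\<close>
  contribute equally on both sides; each remaining one is some \<open>J\<close> together with
  \<open>g\<close> or \<open>g + m\<close>, and the quotient of these two power sums is the factor
  at \<open>J\<close>.\<close>

lemma prod_power_sums_step:
  fixes T :: "nat set"
  assumes "finite T" "g \<notin> T" "g + m \<notin> T" "g \<noteq> 0"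
  shows "(\<Prod>I\<in>{I. I \<subseteq> insert (g + m) T - {0} \<and> card I = Suc q}. \<Sum>a\<in>I. real a ^ k)
    = (\<Prod>I\<in>{I. I \<subseteq> insert g T - {0} \<and> card I = Suc q}. \<Sum>a\<in>I. real a ^ k)
      * (\<Prod>J\<in>{J. J \<subseteq> T - {0} \<and> card J = q}.
          1 + (\<Sum>j=1..k. real (k choose j) * real g ^ (k - j) * real m ^ j)
            / ((\<Sum>a\<in>J. real a ^ k) + real g ^ k))"
proof -
  let ?B = "T - {0}"
  let ?Js = "{J. J \<subseteq> ?B \<and> card J = q}"
  let ?f = "\<lambda>I. \<Sum>a\<in>I. real a ^ k"
  have expand: "(\<Prod>I\<in>{I. I \<subseteq> insert x T - {0} \<and> card I = Suc q}. ?f I)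
      = (\<Prod>I\<in>{I. I \<subseteq> ?B \<and> card I = Suc q}. ?f I) * (\<Prod>J\<in>?Js. ?f J + real x ^ k)"
    if "x \<notin> T" "x \<noteq> 0" for x
  proof -
    have "insert x T - {0} = insert x ?B" using that by auto
    moreover have "?f (insert x J) = ?f J + real x ^ k" if "J \<in> ?Js" for J
      using that \<open>x \<notin> T\<close> assms(1)
      by (subst sum.insert) (auto intro: finite_subset)
    ultimately show ?thesis
      using that assms(1) by (simp add: prod_subsets_insert)
  qed
  have ratio: "1 + (\<Sum>j=1..k. real (k choose j) * real g ^ (k - j) * real m ^ j) / (?f J + real g ^ k)
      = (?f J + real (g + m) ^ k) / (?f J + real g ^ k)" for J
  proof -
    have "?f J + real g ^ k > 0"
      using assms(4) by (intro add_nonneg_pos sum_nonneg) auto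
    then show ?thesis
      using factor_eq_ratio[of "?f J" "real g" k "real m"] by simp
  qed
  have "(\<Prod>J\<in>?Js. ?f J + real g ^ k) \<noteq> 0"
  proof -
    have "?f J + real g ^ k > 0" for J
      using assms(4) by (intro add_nonneg_pos sum_nonneg) auto
    then have "(\<Prod>J\<in>?Js. ?f J + real g ^ k) > 0"
      by (intro prod_pos) auto
    then show ?thesis by simp
  qed
  moreover have "g + m \<noteq> 0" using assms(4) by simp
  ultimately show ?thesis
    unfolding ratio prod_dividef expand[OF assms(2,4)] expand[OF assms(3) \<open>g + m \<noteq> 0\<close>]
    by simp
qed

section \<open>The chain of semigroups and the three product formulas\<close>

lemma gap_semigroup_Suc: "gap_semigroup c (Suc i) = gap_semigroup c i - {c (Suc i)}"
  by (auto simp: gap_semigroup_def atLeastAtMostSuc_conv)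

theorem mainTheorem6:
  fixes S :: "nat set" and m n :: nat and c :: "nat \<Rightarrow> nat"
  assumes "numerical_semigroup S"
    and "S \<noteq> UNIV"
    and "m \<in> S" and "m \<noteq> 0"
    and "strict_mono_on {1..n} c" and "c ` {1..n} = UNIV - S"
  shows
    "(\<forall>k p. 1 \<le> k \<and> 1 \<le> p \<and> p < m \<longrightarrow>
        (\<Prod>i=1..n. \<Prod>J\<in>{J. J \<subseteq> trimmed_apery c m i - {0} \<and> card J = p - 1}.
           1 + (\<Sum>j=1..k. real (k choose j) * real (c i) ^ (k - j) * real m ^ j)
                 / ((\<Sum>a\<in>J. real a ^ k) + real (c i) ^ k))
        = (\<Prod>I\<in>{I. I \<subseteq> apery_set S m - {0} \<and> card I = p}. \<Sum>a\<in>I. real a ^ k)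
          / (\<Prod>I\<in>{I. I \<subseteq> {..<m} - {0} \<and> card I = p}. \<Sum>a\<in>I. real a ^ k))
     \<and> (\<forall>k\<ge>1.
        (\<Prod>i=1..n.
           1 + (\<Sum>j=1..k. real (k choose j) * real (c i) ^ (k - j) * real m ^ j)
                 / ((\<Sum>a\<in>trimmed_apery c m i. real a ^ k) + real (c i) ^ k))
        = (\<Sum>a\<in>apery_set S m. real a ^ k) / (\<Sum>a\<in>{..<m}. real a ^ k))
     \<and> (\<Prod>i=1..n. 1 + real m / real (c i))
        = (\<Prod>a\<in>apery_set S m - {0}. real a) / fact (m - 1)"
proof -
  define A where "A i = apery_set (gap_semigroup c i) m" for i
  have add: "a + b \<in> S" if "a \<in> S" "b \<in> S" for a b
    using assms(1) that by (auto simp: numerical_semigroup_def)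
  have zero: "0 \<in> S"
    using assms(1) by (auto simp: numerical_semigroup_def)
  \<comment> \<open>A semigroup containing 0 and 1 is everything. The resulting
    \<open>m \<ge> 2\<close> puts 1 into \<open>{..<m}\<close>, which later makes the denominator of
    the second formula nonzero.\<close>
  have "m \<noteq> 1"
  proof
    assume "m = 1"
    have "x \<in> S" for x
      by (induction x) (use zero add[of _ 1] \<open>m \<in> S\<close> \<open>m = 1\<close> in auto)
    with assms(2) show False by auto
  qed
  then have "m \<ge> 2" using assms(4) by simp
  have mono: "c i < c j" if "i \<in> {1..n}" "j \<in> {1..n}" "i < j" for i j
    using assms(5) that by (auto simp: strict_mono_on_def)
  have gap: "c i \<notin> S" if "i \<in> {1..n}" for i
    using assms(6) that by blast
  have step: "A i = insert (c (Suc i)) (trimmed_apery c m (Suc i))"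
      "A (Suc i) = insert (c (Suc i) + m) (trimmed_apery c m (Suc i))"
      "c (Suc i) \<notin> trimmed_apery c m (Suc i)" "c (Suc i) + m \<notin> trimmed_apery c m (Suc i)"
      "c (Suc i) \<noteq> 0" if "i < n" for i
  proof -
    let ?g = "c (Suc i)" and ?X = "gap_semigroup c i"
    have less: "c j < ?g" if "j \<in> {1..i}" for j
      using mono[of j "Suc i"] that \<open>i < n\<close> by auto
    have "?g \<notin> S" using gap \<open>i < n\<close> by auto
    then show g0: "?g \<noteq> 0" using zero by metis
    \<comment> \<open>Only \<open>c 1\<close>, ..., \<open>c i\<close> have been removed so far, and
      all of them are smaller than \<open>?g\<close>.\<close>
    have "?g \<in> ?X" "?g + m \<in> ?X"
      using less by (fastforce simp: gap_semigroup_def)+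
    \<comment> \<open>This says that \<open>?g\<close> lies in the Apery set of \<open>?X\<close>.
      If \<open>?g - m\<close> were in \<open>S\<close>, adding \<open>m\<close> would put
      \<open>?g\<close> there too; so it is a gap, and being smaller than \<open>?g\<close> it is
      one of those already removed.\<close>
    moreover have "?g < m \<or> ?g - m \<notin> ?X"
    proof (cases "?g < m")
      case False
      then have "?g - m \<notin> S"
        using add[of "?g - m" m] assms(3) \<open>?g \<notin> S\<close> by auto
      then obtain j where j: "j \<in> {1..n}" "c j = ?g - m"
        using assms(6) by (metis DiffI UNIV_I imageE)
      have "j < Suc i"
      proof (rule ccontr)
        assume "\<not> j < Suc i"
        then have "?g \<le> c j"
          using mono[of "Suc i" j] j(1) \<open>i < n\<close> by (cases "j = Suc i") auto
        with j(2) g0 assms(4) False show False by auto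
      qed
      with j show ?thesis by (force simp: gap_semigroup_def)
    qed simp
    ultimately show "A i = insert ?g (trimmed_apery c m (Suc i))"
      "A (Suc i) = insert (?g + m) (trimmed_apery c m (Suc i))"
      "?g \<notin> trimmed_apery c m (Suc i)" "?g + m \<notin> trimmed_apery c m (Suc i)"
      using apery_set_remove[of ?g ?X m] g0 assms(4)
      unfolding A_def trimmed_apery_def gap_semigroup_Suc by auto
  qed
  have A0: "A 0 = {..<m}"
    by (simp add: A_def gap_semigroup_def apery_set_UNIV)
  have An: "A n = apery_set S m"
    using assms(6) by (simp add: A_def gap_semigroup_def double_diff)
  have "finite (A i)" if "i \<le> n" for i
    using that
  proof (induction i)
    case (Suc i)
    then show ?case using step(1,2)[of i] by auto
  qed (simp add: A0)
  then have fin: "finite (trimmed_apery c m (Suc i))" if "i < n" for i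
    using step(1)[OF that] that by (metis finite_insert less_imp_le)

  have general: "(\<Prod>i=1..n. \<Prod>J\<in>{J. J \<subseteq> trimmed_apery c m i - {0} \<and> card J = p - 1}.
           1 + (\<Sum>j=1..k. real (k choose j) * real (c i) ^ (k - j) * real m ^ j)
                 / ((\<Sum>a\<in>J. real a ^ k) + real (c i) ^ k))
        = (\<Prod>I\<in>{I. I \<subseteq> apery_set S m - {0} \<and> card I = p}. \<Sum>a\<in>I. real a ^ k)
          / (\<Prod>I\<in>{I. I \<subseteq> {..<m} - {0} \<and> card I = p}. \<Sum>a\<in>I. real a ^ k)"
    if "1 \<le> p" for k p
  proof -
    define F where
      "F i = (\<Prod>I\<in>{I. I \<subseteq> A i - {0} \<and> card I = p}. \<Sum>a\<in>I. real a ^ k)" for i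
    define r where "r i = (\<Prod>J\<in>{J. J \<subseteq> trimmed_apery c m i - {0} \<and> card J = p - 1}.
           1 + (\<Sum>j=1..k. real (k choose j) * real (c i) ^ (k - j) * real m ^ j)
                 / ((\<Sum>a\<in>J. real a ^ k) + real (c i) ^ k))" for i
    obtain q where q: "p = Suc q" using \<open>1 \<le> p\<close> by (cases p) auto
    \<comment> \<open>Every \<open>I\<close> here is nonempty as \<open>p \<ge> 1\<close> and avoids
      0, so its power sum is positive.\<close>
    have "F 0 > 0"
      unfolding F_def A0
    proof (intro prod_pos ballI)
      fix I assume I: "I \<in> {I. I \<subseteq> {..<m} - {0} \<and> card I = p}"
      then have "I \<noteq> {}" using \<open>1 \<le> p\<close> by auto
      then obtain x where "x \<in> I" by auto
      with I show "(\<Sum>a\<in>I. real a ^ k) > 0"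
        by (intro sum_powers_pos[of I x]) (auto intro: finite_subset)
    qed
    then have "F 0 \<noteq> 0" by simp
    moreover have "F (Suc i) = F i * r (Suc i)" if "i < n" for i
      using prod_power_sums_step[OF fin step(3,4,5), OF that that that that]
      unfolding F_def r_def step(1,2)[OF that] q diff_Suc_1 .
    ultimately have "(\<Prod>i=1..n. r i) = F n / F 0"
      by (rule prod_telescope_ratio)
    then show ?thesis by (simp only: F_def r_def A0 An)
  qed
  \<comment> \<open>Telescoping the power sum of the whole Apery set, 0 included, gives this
    directly, without specialising \<open>general\<close> to \<open>p = m - 1\<close> and
    identifying the only subset of that size.\<close>
  have sums: "(\<Prod>i=1..n.
           1 + (\<Sum>j=1..k. real (k choose j) * real (c i) ^ (k - j) * real m ^ j)
                 / ((\<Sum>a\<in>trimmed_apery c m i. real a ^ k) + real (c i) ^ k))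
        = (\<Sum>a\<in>apery_set S m. real a ^ k) / (\<Sum>a\<in>{..<m}. real a ^ k)" for k
  proof -
    define F where "F i = (\<Sum>a\<in>A i. real a ^ k)" for i
    define r where "r i = 1 + (\<Sum>j=1..k. real (k choose j) * real (c i) ^ (k - j) * real m ^ j)
                 / ((\<Sum>a\<in>trimmed_apery c m i. real a ^ k) + real (c i) ^ k)" for i
    have "F 0 \<noteq> 0"
      using sum_powers_pos[of "{..<m}" 1 k] \<open>m \<ge> 2\<close> by (simp add: F_def A0)
    moreover have "F (Suc i) = F i * r (Suc i)" if "i < n" for i
    proof -
      let ?s = "\<Sum>a\<in>trimmed_apery c m (Suc i). real a ^ k" and ?g = "c (Suc i)"
      have "?s + real ?g ^ k > 0"
        using step(5)[OF that] by (intro add_nonneg_pos sum_nonneg) auto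
      moreover from this have "r (Suc i) = (?s + (real ?g + real m) ^ k) / (?s + real ?g ^ k)"
        unfolding r_def by (intro factor_eq_ratio) simp
      moreover have "F i = ?s + real ?g ^ k" "F (Suc i) = ?s + (real ?g + real m) ^ k"
        using step(3,4)[OF that] fin[OF that] by (simp_all add: F_def step(1,2)[OF that])
      ultimately show ?thesis by simp
    qed
    ultimately have "(\<Prod>i=1..n. r i) = F n / F 0"
      by (rule prod_telescope_ratio)
    then show ?thesis by (simp add: F_def r_def A0 An)
  qed
  \<comment> \<open>Again a direct telescope, now of the product of the nonzero Apery elements:
    exchanging \<open>?g\<close> for \<open>?g + m\<close> multiplies it by
    \<open>1 + m / ?g\<close>.\<close>
  have products: "(\<Prod>i=1..n. 1 + real m / real (c i))
        = (\<Prod>a\<in>apery_set S m - {0}. real a) / fact (m - 1)"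
  proof -
    define F where "F i = (\<Prod>a\<in>A i - {0}. real a)" for i
    have "{..<m} - {0} = {1..m - 1}" by auto
    then have F0: "F 0 = fact (m - 1)" by (simp add: F_def A0 fact_prod)
    moreover have "F (Suc i) = F i * (1 + real m / real (c (Suc i)))" if "i < n" for i
    proof -
      let ?T = "trimmed_apery c m (Suc i)" and ?g = "c (Suc i)"
      have "A i - {0} = insert ?g (?T - {0})" "A (Suc i) - {0} = insert (?g + m) (?T - {0})"
        using step(5)[OF that] by (auto simp: step(1,2)[OF that])
      then have "F i = real ?g * (\<Prod>a\<in>?T - {0}. real a)"
        "F (Suc i) = real (?g + m) * (\<Prod>a\<in>?T - {0}. real a)"
        using step(3,4)[OF that] fin[OF that] by (simp_all add: F_def)
      then show ?thesis using step(5)[OF that] by (simp add: field_simps)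
    qed
    ultimately show ?thesis
      using prod_telescope_ratio[of F n "\<lambda>i. 1 + real m / real (c i)"] by (simp add: F_def An)
  qed
  show ?thesis using general sums products by blast
qed

end
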